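(* Let $d\ge 1$ and $M\ge 1$ be integers. For any fractional partition $(\mathcal{G},\beta)$ of $[M]$, the inequality $$\big|A_1+\cdots+A_M\big|\ \ge\ \sum_{S\in\mathcal{G}} \beta_S \,\Big|\sum_{i\in S} A_i\Big|$$ holds for all nonempty compact subsets $A_1,\ldots,A_M$ of $\mathbb{R}^d$. In dimension $d=1$, the inequality is an equality when all sets $S\in\mathcal{G}$ with $\beta_S>0$ satisfy that $\sum_{i\in S} A_i$ is an interval.
   Context: $[M]=\{1,\dots,M\}$; $|A|$ denotes the $d$-dimensional Lebesgue measure of a compact set $A\subset\mathbb{R}^d$; sums of sets are Minkowski sums, and a sum over the empty index set is $\{0\}$ (so it has volume $0$). Intervals may be degenerate (a single point). A fractional partition $(\mathcal{G},\beta)$ of $[M]$ is a collection $\mathcal{G}$ of subsets of $[M]$ together with a weight function $\beta:\mathcal{G}\to[0,\infty)$, $S\mapsto\beta_S$, such that $\sum_{S\in\mathcal{G}:\, i\in S}\beta_S=1$ for each $i\in[M]$. *)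

theory Defs
  imports "HOL-Analysis.Analysis" "HOL-Library.Set_Algebras"
begin

text \<open>
  Sums of sets are Minkowski sums: \<^theory>\<open>HOL-Library.Set_Algebras\<close> makes sets over a
  commutative additive monoid again such a monoid, with zero element \<open>{0}\<close>. So for finite \<open>S\<close>
  the expression \<open>\<Sum>i\<in>S. A i\<close> is the Minkowski sum of the family, equal to \<open>{0}\<close> if \<open>S\<close> is empty.
\<close>

definition fractional_partition :: "nat \<Rightarrow> nat set set \<Rightarrow> (nat set \<Rightarrow> real) \<Rightarrow> bool" where
  "fractional_partition M \<G> \<beta> \<longleftrightarrow>
     \<G> \<subseteq> Pow {1..M} \<and>
     (\<forall>S\<in>\<G>. 0 \<le> \<beta> S) \<and>
     (\<forall>i\<in>{1..M}. (\<Sum>S\<in>{S\<in>\<G>. i \<in> S}. \<beta> S) = 1)"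

end

theory Submission
  imports Defs
begin

text \<open>
  The idea is to cut every partial sum \<open>A_S = (\<Sum>i\<in>S. A i)\<close> into one block for each \<open>i \<in> S\<close>, so
  that block \<open>i\<close> of \<open>A_S\<close> is, up to a translation, a subset of block \<open>i\<close> of the full sum. The
  inequality then follows block by block, by averaging over the sets \<open>S \<ni> i\<close> with the weights
  \<open>\<beta> S\<close>, which add up to \<open>1\<close>.

  To define the blocks, fix a direction \<open>u \<noteq> 0\<close> and let \<open>p i\<close> and \<open>q i\<close> be points of the compact set
  \<open>A i\<close> that are lowest and highest in direction \<open>u\<close>. Starting from the lowest point
  \<open>\<Sum>j\<in>S. p j\<close> of \<open>A_S\<close> and replacing the summands \<open>p j\<close> by \<open>q j\<close> one at a time, in increasing
  order of \<open>j\<close>, leads to the highest point \<open>\<Sum>j\<in>S. q j\<close>; the heights of the points met on the way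
  cut \<open>A_S\<close> into slabs. Slab \<open>i\<close>, in which \<open>p i\<close> turns into \<open>q i\<close>, has the thickness of \<open>A i\<close>, in
  every \<open>S\<close> that contains \<open>i\<close>. Adding the fixed points \<open>q j\<close> (for \<open>j < i\<close>) and \<open>p j\<close> (for \<open>j > i\<close>)
  with \<open>j \<notin> S\<close> moves a point of \<open>A_S\<close> into the full sum, and it moves slab \<open>i\<close> of \<open>A_S\<close> exactly
  onto slab \<open>i\<close> of the full sum (\<open>translate_block_subset\<close>).

  In dimension one a partial sum that is an interval has as length the sum of the thicknesses of its
  summands, while the length of the full sum never exceeds the sum of all thicknesses. Double
  counting (\<open>fractional_partition_sum\<close>) turns this into the reverse inequality.
\<close>

section \<open>Minkowski sums\<close>

lemma compact_Minkowski_sum: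
  fixes A :: "'i \<Rightarrow> 'a::euclidean_space set"
  assumes "finite S" "\<And>i. i \<in> S \<Longrightarrow> compact (A i)"
  shows "compact (\<Sum>i\<in>S. A i)"
  using assms
proof (induction S rule: finite_induct)
  case empty
  then show ?case by (simp add: set_zero)
next
  case (insert i S)
  have "compact (A i + (\<Sum>i\<in>S. A i))"
    using insert by (auto simp: set_plus_image compact_Times case_prod_unfold
        intro!: compact_continuous_image continuous_intros)
  with insert show ?case by simp
qed

lemma sum_mem_Minkowski_sum:
  assumes "finite S" "\<And>i. i \<in> S \<Longrightarrow> x i \<in> A i"
  shows "(\<Sum>i\<in>S. x i) \<in> (\<Sum>i\<in>S. A i)"
  using assms by (auto simp: set_sum_alt)

lemma inner_Minkowski_sum_bounds:
  fixes A :: "'i \<Rightarrow> 'a::euclidean_space set"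
  assumes "finite S" "x \<in> (\<Sum>i\<in>S. A i)"
    and "\<And>i y. i \<in> S \<Longrightarrow> y \<in> A i \<Longrightarrow> u \<bullet> p i \<le> u \<bullet> y \<and> u \<bullet> y \<le> u \<bullet> q i"
  shows "u \<bullet> (\<Sum>i\<in>S. p i) \<le> u \<bullet> x" "u \<bullet> x \<le> u \<bullet> (\<Sum>i\<in>S. q i)"
proof -
  obtain y where y: "x = (\<Sum>i\<in>S. y i)" "\<And>i. i \<in> S \<Longrightarrow> y i \<in> A i"
    using assms(1,2) by (auto simp: set_sum_alt)
  show "u \<bullet> (\<Sum>i\<in>S. p i) \<le> u \<bullet> x" "u \<bullet> x \<le> u \<bullet> (\<Sum>i\<in>S. q i)"
    using y assms(3) by (auto simp: inner_sum_right intro!: sum_mono)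
qed

section \<open>Cutting by parallel hyperplanes\<close>

text \<open>
  Slabs are open below and closed above, so that consecutive ones are disjoint, and equal
  thresholds give an empty slab.
\<close>

definition slab :: "'a::euclidean_space \<Rightarrow> real \<Rightarrow> real \<Rightarrow> 'a set" where
  "slab u a b = {x. a < u \<bullet> x \<and> u \<bullet> x \<le> b}"

lemma slab_self: "slab u a a = {}"
  by (auto simp: slab_def)

lemma lmeasurable_Int_slab:
  assumes "S \<in> lmeasurable"
  shows "S \<inter> slab u a b \<in> lmeasurable"
proof -
  have "slab u a b \<in> sets borel"
    unfolding slab_def by measurable
  then show ?thesis
    using assms by (intro fmeasurable_Int_fmeasurable) auto
qed

lemma measure_Int_slab_split:
  fixes L :: "nat \<Rightarrow> real"
  assumes S: "S \<in> lmeasurable" and L: "mono L" and "m \<le> n"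
  shows "measure lebesgue (S \<inter> slab u (L m) (L n)) =
         (\<Sum>i\<in>{m..<n}. measure lebesgue (S \<inter> slab u (L i) (L (Suc i))))"
  using \<open>m \<le> n\<close>
proof (induction n rule: dec_induct)
  case base
  then show ?case by (simp add: slab_self)
next
  case (step n)
  have "L m \<le> L n" "L n \<le> L (Suc n)"
    using L step by (auto simp: mono_def)
  then have "S \<inter> slab u (L m) (L (Suc n)) =
      (S \<inter> slab u (L m) (L n)) \<union> (S \<inter> slab u (L n) (L (Suc n)))"
    by (auto simp: slab_def)
  moreover have "(S \<inter> slab u (L m) (L n)) \<inter> (S \<inter> slab u (L n) (L (Suc n))) = {}"
    by (auto simp: slab_def)
  ultimately show ?case
    using step S by (simp add: measure_Un3 lmeasurable_Int_slab)
qed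

text \<open>
  Only points on the lower bounding hyperplane are lost, and a hyperplane is a null set.
\<close>

lemma measure_Int_slab_covering:
  assumes "u \<noteq> 0" and S: "S \<in> lmeasurable"
    and bounds: "\<And>x. x \<in> S \<Longrightarrow> a \<le> u \<bullet> x \<and> u \<bullet> x \<le> b"
  shows "measure lebesgue (S \<inter> slab u a b) = measure lebesgue S"
proof -
  have "negligible {x. u \<bullet> x = a}"
    using \<open>u \<noteq> 0\<close> by (rule negligible_hyperplane[OF disjI1])
  then have "negligible (sym_diff S (S \<inter> slab u a b))"
    by (rule negligible_subset) (use bounds in \<open>force simp: slab_def\<close>)
  with S show ?thesis
    by (rule measure_negligible_symdiff)
qed

section \<open>Blocks of a Minkowski sum\<close>

text \<open>
  The point reached on the way from \<open>\<Sum>j\<in>S. p j\<close> to \<open>\<Sum>j\<in>S. q j\<close> when the summands with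
  index below \<open>t\<close> have been switched.
\<close>

definition switch_sum :: "(nat \<Rightarrow> 'a::comm_monoid_add) \<Rightarrow> (nat \<Rightarrow> 'a) \<Rightarrow> nat set \<Rightarrow> nat \<Rightarrow> 'a" where
  "switch_sum p q S t = (\<Sum>j\<in>S. if j < t then q j else p j)"

definition block ::
  "'a::euclidean_space \<Rightarrow> (nat \<Rightarrow> 'a) \<Rightarrow> (nat \<Rightarrow> 'a) \<Rightarrow> (nat \<Rightarrow> 'a set) \<Rightarrow> nat set \<Rightarrow> nat \<Rightarrow> 'a set" where
  "block u p q A S i =
     (\<Sum>j\<in>S. A j) \<inter> slab u (u \<bullet> switch_sum p q S i) (u \<bullet> switch_sum p q S (Suc i))"

lemma switch_sum_Suc_outside:
  assumes "i \<notin> S"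
  shows "switch_sum p q S (Suc i) = switch_sum p q S i"
  unfolding switch_sum_def using assms by (intro sum.cong) (auto simp: less_Suc_eq)

lemma switch_sum_subset_diff:
  assumes "S \<subseteq> T" "finite T"
  shows "switch_sum p q T t = switch_sum p q (T - S) t + switch_sum p q S t"
  unfolding switch_sum_def using assms by (rule sum.subset_diff)

lemma block_outside:
  assumes "i \<notin> S"
  shows "block u p q A S i = {}"
  using assms by (simp add: block_def switch_sum_Suc_outside slab_self)

lemma lmeasurable_block:
  fixes A :: "nat \<Rightarrow> 'a::euclidean_space set"
  assumes "finite S" "\<And>i. i \<in> S \<Longrightarrow> compact (A i)"
  shows "block u p q A S i \<in> lmeasurable"
  unfolding block_def
  by (intro lmeasurable_Int_slab lmeasurable_compact compact_Minkowski_sum assms)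

text \<open>
  The translation vector is a point of the sum of the sets missing from \<open>S\<close>, so it moves the
  sum over \<open>S\<close> into the sum over \<open>T\<close>. As \<open>i\<close> is not among the missing indices, the vector is the
  same for the lower and for the upper face of slab \<open>i\<close>, and both faces arrive where they should.
\<close>

lemma translate_block_subset:
  fixes A :: "nat \<Rightarrow> 'a::euclidean_space set"
  assumes "finite T" "S \<subseteq> T" "i \<in> S"
    and "\<And>j. j \<in> T \<Longrightarrow> p j \<in> A j" "\<And>j. j \<in> T \<Longrightarrow> q j \<in> A j"
  shows "(+) (switch_sum p q (T - S) i) ` block u p q A S i \<subseteq> block u p q A T i"
proof
  let ?v = "switch_sum p q (T - S) i"
  fix y assume "y \<in> (+) ?v ` block u p q A S i"
  then obtain x where y: "y = ?v + x" and x: "x \<in> block u p q A S i"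
    by blast
  have "?v \<in> (\<Sum>j\<in>T - S. A j)"
    unfolding switch_sum_def using assms by (intro sum_mem_Minkowski_sum) auto
  then have "y \<in> (\<Sum>j\<in>T - S. A j) + (\<Sum>j\<in>S. A j)"
    unfolding y using x by (auto simp: block_def)
  then have "y \<in> (\<Sum>j\<in>T. A j)"
    using sum.subset_diff[OF assms(2,1), of A] by simp
  moreover have "switch_sum p q (T - S) (Suc i) = ?v"
    using \<open>i \<in> S\<close> by (intro switch_sum_Suc_outside) simp
  ultimately show "y \<in> block u p q A T i"
    using x assms(1,2)
    by (simp add: y block_def slab_def switch_sum_subset_diff[of S T] inner_add_right)
qed

lemma measure_block_mono:
  fixes A :: "nat \<Rightarrow> 'a::euclidean_space set"
  assumes "finite T" "S \<subseteq> T" "i \<in> S"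
    and "\<And>j. j \<in> T \<Longrightarrow> compact (A j)"
    and "\<And>j. j \<in> T \<Longrightarrow> p j \<in> A j" "\<And>j. j \<in> T \<Longrightarrow> q j \<in> A j"
  shows "measure lebesgue (block u p q A S i) \<le> measure lebesgue (block u p q A T i)"
proof -
  let ?v = "switch_sum p q (T - S) i"
  have meas: "block u p q A S i \<in> lmeasurable" "block u p q A T i \<in> lmeasurable"
    using assms by (auto intro!: lmeasurable_block dest: finite_subset)
  have "measure lebesgue (block u p q A S i) = measure lebesgue ((+) ?v ` block u p q A S i)"
    by (simp add: measure_translation)
  also have "\<dots> \<le> measure lebesgue (block u p q A T i)"
    using meas translate_block_subset[OF assms(1-3,5,6)]
    by (intro measure_mono_fmeasurable) (auto intro!: fmeasurableD measurable_translation)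
  finally show ?thesis .
qed

text \<open>
  The thresholds increase from the lowest to the highest level of the sum as the switching index
  runs from \<open>1\<close> to \<open>M + 1\<close>, so the slabs cut out all of the sum up to a null set. An index
  outside \<open>S\<close> switches nothing and gives an empty block, which leaves the indices in \<open>S\<close>. For
  empty \<open>S\<close> this says that the singleton \<open>{0}\<close> has volume \<open>0\<close>.
\<close>

lemma measure_sum_blocks:
  fixes A :: "nat \<Rightarrow> 'a::euclidean_space set"
  assumes "u \<noteq> 0" "S \<subseteq> {1..M}"
    and comp: "\<And>i. i \<in> S \<Longrightarrow> compact (A i)"
    and bounds: "\<And>i y. i \<in> S \<Longrightarrow> y \<in> A i \<Longrightarrow> u \<bullet> p i \<le> u \<bullet> y \<and> u \<bullet> y \<le> u \<bullet> q i"
    and mem: "\<And>i. i \<in> S \<Longrightarrow> p i \<in> A i"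
  shows "measure lebesgue (\<Sum>i\<in>S. A i) = (\<Sum>i\<in>S. measure lebesgue (block u p q A S i))"
proof -
  define L where "L t = u \<bullet> switch_sum p q S t" for t
  have fin: "finite S"
    using assms(2) finite_subset by blast
  have meas: "(\<Sum>i\<in>S. A i) \<in> lmeasurable"
    by (intro lmeasurable_compact compact_Minkowski_sum fin comp)
  have "mono L"
    using bounds mem
    by (auto simp: mono_def L_def switch_sum_def inner_sum_right intro!: sum_mono)
  have "switch_sum p q S 1 = (\<Sum>i\<in>S. p i)" "switch_sum p q S (Suc M) = (\<Sum>i\<in>S. q i)"
    unfolding switch_sum_def using assms(2) by (auto intro!: sum.cong)
  then have "L 1 \<le> u \<bullet> x \<and> u \<bullet> x \<le> L (Suc M)" if "x \<in> (\<Sum>i\<in>S. A i)" for x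
    using inner_Minkowski_sum_bounds[OF fin that bounds] by (simp add: L_def)
  then have "measure lebesgue (\<Sum>i\<in>S. A i) =
      measure lebesgue ((\<Sum>i\<in>S. A i) \<inter> slab u (L 1) (L (Suc M)))"
    using measure_Int_slab_covering[OF \<open>u \<noteq> 0\<close> meas] by simp
  also have "\<dots> = (\<Sum>i\<in>{1..<Suc M}. measure lebesgue (block u p q A S i))"
    using measure_Int_slab_split[OF meas \<open>mono L\<close>, of 1 "Suc M"] by (simp add: block_def L_def)
  also have "\<dots> = (\<Sum>i\<in>S. measure lebesgue (block u p q A S i))"
    using assms(2) by (intro sum.mono_neutral_right) (auto simp: block_outside)
  finally show ?thesis .
qed

section \<open>One-dimensional sums\<close>

lemma measure_cbox_dim1:
  fixes a b u :: "'a::euclidean_space"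
  assumes "Basis = {u}" "u \<bullet> a \<le> u \<bullet> b"
  shows "measure lebesgue (cbox a b) = u \<bullet> b - u \<bullet> a"
proof -
  have "measure lebesgue (cbox a b) = (\<Prod>i\<in>Basis. b \<bullet> i - a \<bullet> i)"
    using assms(2) content_cbox[of a b, unfolded \<open>Basis = {u}\<close>]
    unfolding \<open>Basis = {u}\<close> by (simp add: inner_commute[of u])
  then show ?thesis
    unfolding \<open>Basis = {u}\<close> by (simp add: inner_commute)
qed

text \<open>
  With respect to the end points \<open>\<Sum>i\<in>S. p i\<close> and \<open>\<Sum>i\<in>S. q i\<close>, any sum lies in the segment
  between them, and a sum that is an interval contains this segment. The next two lemmas compare
  lengths accordingly.
\<close>

lemma measure_Minkowski_sum_le_dim1:
  fixes A :: "'i \<Rightarrow> 'a::euclidean_space set"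
  assumes u: "Basis = {u}" and "finite S" and comp: "\<And>i. i \<in> S \<Longrightarrow> compact (A i)"
    and bounds: "\<And>i y. i \<in> S \<Longrightarrow> y \<in> A i \<Longrightarrow> u \<bullet> p i \<le> u \<bullet> y \<and> u \<bullet> y \<le> u \<bullet> q i"
    and mem: "\<And>i. i \<in> S \<Longrightarrow> p i \<in> A i"
  shows "measure lebesgue (\<Sum>i\<in>S. A i) \<le> (\<Sum>i\<in>S. u \<bullet> q i - u \<bullet> p i)"
proof -
  have "(\<Sum>i\<in>S. A i) \<subseteq> cbox (\<Sum>i\<in>S. p i) (\<Sum>i\<in>S. q i)"
    using inner_Minkowski_sum_bounds[OF \<open>finite S\<close> _ bounds]
    by (auto simp: mem_box u inner_commute)
  then have "measure lebesgue (\<Sum>i\<in>S. A i) \<le> measure lebesgue (cbox (\<Sum>i\<in>S. p i) (\<Sum>i\<in>S. q i))"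
    by (intro measure_mono_fmeasurable fmeasurableD lmeasurable_compact
        compact_Minkowski_sum \<open>finite S\<close> comp lmeasurable_cbox)
  also have "\<dots> = (\<Sum>i\<in>S. u \<bullet> q i - u \<bullet> p i)"
    using bounds mem
    by (subst measure_cbox_dim1[OF u]) (auto simp: inner_sum_right sum_subtractf intro!: sum_mono)
  finally show ?thesis .
qed

lemma measure_interval_Minkowski_sum_ge_dim1:
  fixes A :: "'i \<Rightarrow> 'a::euclidean_space set"
  assumes u: "Basis = {u}" and "finite S" and comp: "\<And>i. i \<in> S \<Longrightarrow> compact (A i)"
    and mem: "\<And>i. i \<in> S \<Longrightarrow> p i \<in> A i" "\<And>i. i \<in> S \<Longrightarrow> q i \<in> A i"
    and le: "\<And>i. i \<in> S \<Longrightarrow> u \<bullet> p i \<le> u \<bullet> q i"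
    and int: "is_interval (\<Sum>i\<in>S. A i)"
  shows "(\<Sum>i\<in>S. u \<bullet> q i - u \<bullet> p i) \<le> measure lebesgue (\<Sum>i\<in>S. A i)"
proof -
  have ends: "(\<Sum>i\<in>S. p i) \<in> (\<Sum>i\<in>S. A i)" "(\<Sum>i\<in>S. q i) \<in> (\<Sum>i\<in>S. A i)"
    using \<open>finite S\<close> mem by (auto intro!: sum_mem_Minkowski_sum)
  have "cbox (\<Sum>i\<in>S. p i) (\<Sum>i\<in>S. q i) \<subseteq> (\<Sum>i\<in>S. A i)"
    using mem_is_intervalI[OF int ends] by (auto simp: mem_box)
  then have "measure lebesgue (cbox (\<Sum>i\<in>S. p i) (\<Sum>i\<in>S. q i)) \<le> measure lebesgue (\<Sum>i\<in>S. A i)"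
    by (intro measure_mono_fmeasurable fmeasurableD lmeasurable_compact
        compact_Minkowski_sum \<open>finite S\<close> comp lmeasurable_cbox)
  moreover have "measure lebesgue (cbox (\<Sum>i\<in>S. p i) (\<Sum>i\<in>S. q i)) = (\<Sum>i\<in>S. u \<bullet> q i - u \<bullet> p i)"
    using le
    by (subst measure_cbox_dim1[OF u]) (auto simp: inner_sum_right sum_subtractf intro!: sum_mono)
  ultimately show ?thesis by simp
qed

section \<open>Averaging over a fractional partition\<close>

lemma fractional_partition_finite:
  assumes "fractional_partition M \<G> \<beta>"
  shows "finite \<G>"
  using assms finite_subset[of \<G> "Pow {1..M}"] by (simp add: fractional_partition_def)

lemma fractional_partition_sum_swap:
  assumes "fractional_partition M \<G> \<beta>"
  shows "(\<Sum>S\<in>\<G>. \<beta> S * (\<Sum>i\<in>S. c S i)) = (\<Sum>i\<in>{1..M}. \<Sum>S\<in>{S\<in>\<G>. i \<in> S}. \<beta> S * c S i)"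
proof -
  have "{i. i \<in> {1..M} \<and> i \<in> S} = S" if "S \<in> \<G>" for S
    using assms that unfolding fractional_partition_def by blast
  then have "(\<Sum>S\<in>\<G>. \<beta> S * (\<Sum>i\<in>S. c S i)) =
      (\<Sum>S\<in>\<G>. \<Sum>i | i \<in> {1..M} \<and> i \<in> S. \<beta> S * c S i)"
    unfolding sum_distrib_left by (intro sum.cong) simp_all
  also have "\<dots> = (\<Sum>i\<in>{1..M}. \<Sum>S\<in>{S\<in>\<G>. i \<in> S}. \<beta> S * c S i)"
    by (intro sum.swap_restrict fractional_partition_finite[OF assms]) auto
  finally show ?thesis .
qed

text \<open>
  Fractional partitions average additive set functions without loss: every \<open>d i\<close> is counted with
  total weight \<open>1\<close>.
\<close>

lemma fractional_partition_sum:
  assumes "fractional_partition M \<G> \<beta>"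
  shows "(\<Sum>S\<in>\<G>. \<beta> S * (\<Sum>i\<in>S. d i)) = (\<Sum>i\<in>{1..M}. d i)"
  unfolding fractional_partition_sum_swap[OF assms] sum_distrib_right[symmetric]
  using assms by (intro sum.cong) (auto simp: fractional_partition_def)

lemma fractional_partition_sum_le:
  assumes "fractional_partition M \<G> \<beta>"
    and "\<And>S i. S \<in> \<G> \<Longrightarrow> i \<in> S \<Longrightarrow> c S i \<le> d i"
  shows "(\<Sum>S\<in>\<G>. \<beta> S * (\<Sum>i\<in>S. c S i)) \<le> (\<Sum>i\<in>{1..M}. d i)"
proof -
  have "(\<Sum>S\<in>\<G>. \<beta> S * (\<Sum>i\<in>S. c S i)) \<le> (\<Sum>S\<in>\<G>. \<beta> S * (\<Sum>i\<in>S. d i))"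
    using assms by (intro sum_mono mult_left_mono) (auto simp: fractional_partition_def)
  then show ?thesis
    by (simp add: fractional_partition_sum[OF assms(1)])
qed

section \<open>Fractional superadditivity of volume\<close>

theorem theorem2:
  fixes M :: nat
    and \<G> :: "nat set set"
    and \<beta> :: "nat set \<Rightarrow> real"
    and A :: "nat \<Rightarrow> 'a::euclidean_space set"
  assumes "M \<ge> 1"
    and "fractional_partition M \<G> \<beta>"
    and "\<And>i. i \<in> {1..M} \<Longrightarrow> compact (A i)"
    and "\<And>i. i \<in> {1..M} \<Longrightarrow> A i \<noteq> {}"
  shows "measure lebesgue (\<Sum>i\<in>{1..M}. A i) \<ge> (\<Sum>S\<in>\<G>. \<beta> S * measure lebesgue (\<Sum>i\<in>S. A i)) \<and>
         (DIM('a) = 1 \<longrightarrow> (\<forall>S\<in>\<G>. \<beta> S > 0 \<longrightarrow> is_interval (\<Sum>i\<in>S. A i)) \<longrightarrow>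
            measure lebesgue (\<Sum>i\<in>{1..M}. A i) = (\<Sum>S\<in>\<G>. \<beta> S * measure lebesgue (\<Sum>i\<in>S. A i)))"
proof -
  note fp = assms(2) and comp = assms(3)
  have G: "S \<subseteq> {1..M}" "finite S" "0 \<le> \<beta> S" if "S \<in> \<G>" for S
    using fp that by (auto simp: fractional_partition_def intro: finite_subset)
  (* Any nonzero direction gives the inequality; a basis vector also serves in dimension one. *)
  obtain u :: 'a where u: "u \<in> Basis"
    using nonempty_Basis by blast
  then have "u \<noteq> 0" by (rule nonzero_Basis)
  have cont: "continuous_on (A i) (\<lambda>x. u \<bullet> x)" for i
    by (intro continuous_intros)
  have "\<exists>x. x \<in> A i \<and> (\<forall>y\<in>A i. u \<bullet> x \<le> u \<bullet> y)" if "i \<in> {1..M}" for i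
    using continuous_attains_inf[OF comp[OF that] assms(4)[OF that] cont] by blast
  then obtain p where p: "\<And>i. i \<in> {1..M} \<Longrightarrow> p i \<in> A i"
    "\<And>i y. i \<in> {1..M} \<Longrightarrow> y \<in> A i \<Longrightarrow> u \<bullet> p i \<le> u \<bullet> y"
    by metis
  have "\<exists>x. x \<in> A i \<and> (\<forall>y\<in>A i. u \<bullet> y \<le> u \<bullet> x)" if "i \<in> {1..M}" for i
    using continuous_attains_sup[OF comp[OF that] assms(4)[OF that] cont] by blast
  then obtain q where q: "\<And>i. i \<in> {1..M} \<Longrightarrow> q i \<in> A i"
    "\<And>i y. i \<in> {1..M} \<Longrightarrow> y \<in> A i \<Longrightarrow> u \<bullet> y \<le> u \<bullet> q i"
    by metis
  let ?b = "\<lambda>S i. measure lebesgue (block u p q A S i)"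
  have blocks: "measure lebesgue (\<Sum>i\<in>S. A i) = (\<Sum>i\<in>S. ?b S i)" if "S \<subseteq> {1..M}" for S
    using that by (intro measure_sum_blocks[OF \<open>u \<noteq> 0\<close> that] comp p conjI q) auto
  have block_le: "?b S i \<le> ?b {1..M} i" if "S \<in> \<G>" "i \<in> S" for S i
    using G(1)[OF that(1)] that(2) by (intro measure_block_mono comp p q) auto
  have "(\<Sum>S\<in>\<G>. \<beta> S * measure lebesgue (\<Sum>i\<in>S. A i)) = (\<Sum>S\<in>\<G>. \<beta> S * (\<Sum>i\<in>S. ?b S i))"
    using G(1) by (intro sum.cong) (auto simp: blocks)
  also have "\<dots> \<le> (\<Sum>i\<in>{1..M}. ?b {1..M} i)"
    by (rule fractional_partition_sum_le[OF fp block_le])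
  finally have ge: "(\<Sum>S\<in>\<G>. \<beta> S * measure lebesgue (\<Sum>i\<in>S. A i)) \<le> measure lebesgue (\<Sum>i\<in>{1..M}. A i)"
    by (simp add: blocks)
  moreover have "measure lebesgue (\<Sum>i\<in>{1..M}. A i) \<le> (\<Sum>S\<in>\<G>. \<beta> S * measure lebesgue (\<Sum>i\<in>S. A i))"
    if "DIM('a) = 1" and int: "\<forall>S\<in>\<G>. \<beta> S > 0 \<longrightarrow> is_interval (\<Sum>i\<in>S. A i)"
  proof -
    have B: "Basis = {u}"
      using \<open>DIM('a) = 1\<close> u by (metis card_1_singletonE singletonD)
    have "measure lebesgue (\<Sum>i\<in>{1..M}. A i) \<le> (\<Sum>i\<in>{1..M}. u \<bullet> q i - u \<bullet> p i)"
      by (intro measure_Minkowski_sum_le_dim1[OF B] comp p conjI q) auto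
    also have "\<dots> = (\<Sum>S\<in>\<G>. \<beta> S * (\<Sum>i\<in>S. u \<bullet> q i - u \<bullet> p i))"
      by (rule fractional_partition_sum[OF fp, symmetric])
    also have "\<dots> \<le> (\<Sum>S\<in>\<G>. \<beta> S * measure lebesgue (\<Sum>i\<in>S. A i))"
    proof (rule sum_mono)
      fix S assume S: "S \<in> \<G>"
      show "\<beta> S * (\<Sum>i\<in>S. u \<bullet> q i - u \<bullet> p i) \<le> \<beta> S * measure lebesgue (\<Sum>i\<in>S. A i)"
      (* For weight 0 the sum over S may fail to be an interval, but it contributes nothing. *)
      proof (cases "\<beta> S = 0")
        case False
        with int G(3)[OF S] S have "is_interval (\<Sum>i\<in>S. A i)" by auto
        with G[OF S] show ?thesis
          by (intro mult_left_mono measure_interval_Minkowski_sum_ge_dim1[OF B] comp p q) auto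
      qed simp
    qed
    finally show ?thesis .
  qed
  ultimately show ?thesis by (auto intro: antisym)
qed

end
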